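(* Let $X$ be a nonempty finite set and let $B\in\mathrm{Mat}_X(\mathbb{R})$ be a nonnegative matrix. There exists a polynomial $p\in\mathbb{C}[t]$ such that $p(B)=J$ if and only if $B$ is irreducible and $\lambda$-doubly stochastic (for some $\lambda\in\mathbb{R}$). Moreover, in this case, writing the minimal polynomial of $B$ as $(t-\lambda)q(t)$, one has $q(\lambda)\neq 0$, and the unique polynomial $h$ of smallest degree satisfying $h(B)=J$ is $$h(t)=\frac{|X|}{q(\lambda)}\,q(t).$$
   Context: $\mathrm{Mat}_X(\mathbb{R})$ is the algebra of real matrices with rows and columns indexed by $X$; $J$ is the all-ones matrix in it. A matrix is nonnegative if all its entries are $\ge 0$. A nonnegative matrix $B\in\mathrm{Mat}_X(\mathbb{R})$ is called $\lambda$-doubly stochastic if $\sum_{z\in X}(B)_{yz}=\sum_{z\in X}(B)_{zy}=\lambda$ for every $y\in X$. A square matrix $B$ is reducible if there is a permutation matrix $P$ such that $P^\top BP=\begin{pmatrix}Y_1&Y_2\\ O&Y_3\end{pmatrix}$ with $Y_1,Y_3$ square (of positive size) and $O$ a zero block; otherwise it is irreducible. *)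

theory Defs
  imports "HOL-Analysis.Analysis" "HOL-Computational_Algebra.Polynomial"
begin

(* The finite nonempty set X is the index type 'n, so Mat_X(R) is real^'n^'n.
   On that type the class operations *, 1 and ^ are not matrix operations (times is
   entrywise); the matrix product is ** and the identity matrix is mat 1. *)

primrec mat_power :: "'a::semiring_1^'n^'n \<Rightarrow> nat \<Rightarrow> 'a^'n^'n" where
  "mat_power A 0 = mat 1"
| "mat_power A (Suc k) = A ** mat_power A k"

definition poly_mat :: "'a::comm_ring_1 poly \<Rightarrow> 'a^'n^'n \<Rightarrow> 'a^'n^'n" where
  "poly_mat p A = (\<chi> x y. \<Sum>i\<le>degree p. coeff p i * mat_power A i $ x $ y)"

definition min_poly :: "'a::field^'n^'n \<Rightarrow> 'a poly" where
  "min_poly A = (THE m. is_arg_min degree (\<lambda>p. lead_coeff p = 1 \<and> poly_mat p A = 0) m)"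

definition all_ones :: "'a::one^'n^'n" where
  "all_ones = (\<chi> x y. 1)"

definition complex_mat :: "real^'n^'n \<Rightarrow> complex^'n^'n" where
  "complex_mat = map_matrix complex_of_real"

definition nonneg_matrix :: "real^'n^'n \<Rightarrow> bool" where
  "nonneg_matrix B \<longleftrightarrow> (\<forall>x y. 0 \<le> B $ x $ y)"

definition doubly_stochastic :: "real \<Rightarrow> real^'n^'n \<Rightarrow> bool" where
  "doubly_stochastic lam B \<longleftrightarrow> nonneg_matrix B \<and>
     (\<forall>y. (\<Sum>z\<in>UNIV. B $ y $ z) = lam \<and> (\<Sum>z\<in>UNIV. B $ z $ y) = lam)"

definition permutation_matrix :: "'a::zero_neq_one^'n^'n \<Rightarrow> bool" where
  "permutation_matrix P \<longleftrightarrow> (\<exists>\<pi>. bij \<pi> \<and> P = (\<chi> x y. if x = \<pi> y then 1 else 0))"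

(* The shape (Y1 Y2; O Y3) with Y1 of size k and Y3 of size |X| - k, both positive, when the
   rows and columns are listed in the order e 0, e 1, ..., e (|X| - 1). *)
definition block_upper_triangular :: "(nat \<Rightarrow> 'n) \<Rightarrow> 'a::zero^'n^'n \<Rightarrow> bool" where
  "block_upper_triangular e C \<longleftrightarrow>
     (\<exists>k. 0 < k \<and> k < CARD('n) \<and> (\<forall>i j. k \<le> i \<and> i < CARD('n) \<and> j < k \<longrightarrow> C $ e i $ e j = 0))"

(* The index type carries no order, so an enumeration e of it is chosen to speak of blocks;
   which one is immaterial, because P ranges over all permutation matrices. *)
definition reducible_matrix :: "'a::semiring_1^'n^'n \<Rightarrow> bool" where
  "reducible_matrix B \<longleftrightarrow>
     (\<exists>e P. bij_betw e {..<CARD('n)} (UNIV :: 'n set) \<and> permutation_matrix P \<and>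
        block_upper_triangular e (transpose P ** B ** P))"

definition irreducible_matrix :: "'a::semiring_1^'n^'n \<Rightarrow> bool" where
  "irreducible_matrix B \<longleftrightarrow> \<not> reducible_matrix B"

end

theory Submission
  imports Defs
begin

text \<open>If \<open>J\<close> is a polynomial in \<open>B\<close>, it commutes with \<open>B\<close>, so all row and column sums of \<open>B\<close>
  agree; and every polynomial in a reducible matrix keeps its zero block. Conversely, write the
  minimal polynomial as \<open>(t - \<lambda>) q\<close>. The columns of \<open>q(B)\<close> are eigenvectors for \<open>\<lambda>\<close>, hence constant
  by the maximum principle for irreducible \<open>B\<close>. The column sums of \<open>q(B)\<close> are \<open>q(\<lambda>)\<close>, so
  \<open>q(B) = (q(\<lambda>) / |X|) J\<close>, and \<open>q(\<lambda>) \<noteq> 0\<close> because \<open>q(B) \<noteq> 0\<close>.\<close>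

section \<open>Evaluating polynomials at matrices\<close>

text \<open>Coefficients above the degree vanish, so polynomials of different degrees can be summed
  over one common range.\<close>

lemma poly_mat_nth:
  assumes "degree p \<le> N"
  shows "poly_mat p A $ x $ y = (\<Sum>i\<le>N. coeff p i * mat_power A i $ x $ y)"
proof -
  have "(\<Sum>i\<le>degree p. coeff p i * mat_power A i $ x $ y) =
        (\<Sum>i\<le>N. coeff p i * mat_power A i $ x $ y)"
    by (rule sum.mono_neutral_left) (use assms in \<open>auto simp: not_le coeff_eq_0\<close>)
  then show ?thesis
    by (simp add: poly_mat_def)
qed

lemma poly_mat_0 [simp]: "poly_mat 0 A = 0"
  by (simp add: vec_eq_iff poly_mat_def)

lemma poly_mat_diff: "poly_mat (p - q) A = poly_mat p A - poly_mat q A"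
proof -
  define N where "N = max (degree p) (degree q)"
  have "degree p \<le> N" "degree q \<le> N" "degree (p - q) \<le> N"
    by (auto simp: N_def degree_diff_le)
  then show ?thesis
    by (simp add: vec_eq_iff poly_mat_nth[of _ N] sum_subtractf algebra_simps)
qed

lemma poly_mat_smult_nth: "poly_mat (smult c p) A $ x $ y = c * poly_mat p A $ x $ y"
  using poly_mat_nth[OF degree_smult_le, of c p A x y]
  by (simp add: poly_mat_nth[OF order_refl, of p] sum_distrib_left mult.assoc)

text \<open>The Horner step, which opens polynomials in a matrix to induction on the
  polynomial.\<close>

lemma poly_mat_pCons:
  fixes A :: "'a::comm_ring_1^'n^'n"
  shows "poly_mat (pCons a p) A = mat a + A ** poly_mat p A"
proof -
  have "poly_mat (pCons a p) A $ x $ y = (mat a + A ** poly_mat p A) $ x $ y" for x y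
  proof -
    have "poly_mat (pCons a p) A $ x $ y =
        (\<Sum>i\<le>Suc (degree p). coeff (pCons a p) i * mat_power A i $ x $ y)"
      by (rule poly_mat_nth) (rule degree_pCons_le)
    also have "\<dots> = mat a $ x $ y + (\<Sum>i\<le>degree p. coeff p i * (A ** mat_power A i) $ x $ y)"
      by (subst sum.atMost_Suc_shift) (simp add: mat_def)
    also have "(\<Sum>i\<le>degree p. coeff p i * (A ** mat_power A i) $ x $ y) =
        (\<Sum>i\<le>degree p. \<Sum>z\<in>UNIV. A $ x $ z * (coeff p i * mat_power A i $ z $ y))"
      by (simp add: matrix_matrix_mult_def sum_distrib_left algebra_simps)
    also have "\<dots> = (A ** poly_mat p A) $ x $ y"
      by (subst sum.swap) (simp add: matrix_matrix_mult_def poly_mat_def sum_distrib_left)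
    finally show ?thesis
      by simp
  qed
  then show ?thesis
    by (simp add: vec_eq_iff)
qed

lemma mat_mult_commute:
  fixes A :: "'a::comm_ring_1^'n^'n"
  shows "mat a ** A = A ** mat a"
  by (simp add: vec_eq_iff matrix_matrix_mult_def mat_def if_distrib if_distribR mult.commute
      cong: if_cong)

lemma poly_mat_commute:
  fixes A :: "'a::comm_ring_1^'n^'n"
  shows "poly_mat p A ** A = A ** poly_mat p A"
proof (induction p)
  case 0
  then show ?case
    by (simp add: vec_eq_iff matrix_matrix_mult_def)
next
  case (pCons a p)
  have "poly_mat (pCons a p) A ** A = mat a ** A + A ** (poly_mat p A ** A)"
    by (simp add: poly_mat_pCons matrix_mul_assoc)
      (simp add: vec_eq_iff matrix_matrix_mult_def sum.distrib distrib_right)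
  then show ?case
    by (simp add: pCons.IH poly_mat_pCons matrix_add_ldistrib mat_mult_commute)
qed

text \<open>When the left side vanishes, the columns of \<open>poly_mat q A\<close> satisfy the
  eigenvector equation of \<open>A\<close> for \<open>c\<close>.\<close>

lemma poly_mat_linear_mult_nth:
  fixes A :: "'a::comm_ring_1^'n^'n"
  shows "poly_mat ([:- c, 1:] * q) A $ x $ y =
    (A ** poly_mat q A) $ x $ y - c * poly_mat q A $ x $ y"
proof -
  have "[:- c, 1:] * q = pCons 0 q - smult c q"
    by simp
  then show ?thesis
    by (simp add: poly_mat_diff poly_mat_pCons poly_mat_smult_nth)
qed

text \<open>The all-ones vector satisfies the eigenvector equation of \<open>A\<close> for
  \<open>c\<close>, hence that of \<open>poly_mat p A\<close> for \<open>poly p c\<close>.\<close>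

lemma poly_mat_row_sum:
  fixes A :: "'a::comm_ring_1^'n^'n"
  assumes "\<And>x. (\<Sum>y\<in>UNIV. A $ x $ y) = c"
  shows "(\<Sum>y\<in>UNIV. poly_mat p A $ x $ y) = poly p c"
proof (induction p arbitrary: x)
  case 0
  then show ?case
    by simp
next
  case (pCons a p)
  have "(\<Sum>y\<in>UNIV. (A ** poly_mat p A) $ x $ y) =
      (\<Sum>z\<in>UNIV. A $ x $ z * (\<Sum>y\<in>UNIV. poly_mat p A $ z $ y))"
    by (simp add: matrix_matrix_mult_def sum_distrib_left) (rule sum.swap)
  also have "\<dots> = c * poly p c"
    by (simp add: pCons.IH assms flip: sum_distrib_right)
  finally show ?case
    by (simp add: poly_mat_pCons sum.distrib mat_def)
qed

lemma poly_mat_column_sum: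
  fixes A :: "'a::comm_ring_1^'n^'n"
  assumes "\<And>y. (\<Sum>x\<in>UNIV. A $ x $ y) = c"
  shows "(\<Sum>x\<in>UNIV. poly_mat p A $ x $ y) = poly p c"
proof (induction p arbitrary: y)
  case 0
  then show ?case
    by simp
next
  case (pCons a p)
  have "(\<Sum>x\<in>UNIV. (A ** poly_mat p A) $ x $ y) =
      (\<Sum>z\<in>UNIV. (\<Sum>x\<in>UNIV. A $ x $ z) * poly_mat p A $ z $ y)"
    by (simp add: matrix_matrix_mult_def sum_distrib_right) (rule sum.swap)
  also have "\<dots> = c * poly p c"
    by (simp add: pCons.IH assms flip: sum_distrib_left)
  finally show ?case
    by (simp add: poly_mat_pCons sum.distrib mat_def)
qed

text \<open>The matrices with this zero block preserve the coordinate subspace of \<open>S\<close>;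
  they form an algebra containing the scalar matrices.\<close>

lemma poly_mat_zero_block:
  fixes A :: "'a::comm_ring_1^'n^'n"
  assumes "\<And>x y. x \<notin> S \<Longrightarrow> y \<in> S \<Longrightarrow> A $ x $ y = 0" and "x \<notin> S" "y \<in> S"
  shows "poly_mat p A $ x $ y = 0"
  using assms(2)
proof (induction p arbitrary: x)
  case 0
  then show ?case
    by simp
next
  case (pCons a p)
  have "A $ x $ z * poly_mat p A $ z $ y = 0" for z
    using pCons assms(1) by (cases "z \<in> S") auto
  moreover have "x \<noteq> y"
    using pCons.prems assms(3) by blast
  ultimately show ?case
    by (simp add: poly_mat_pCons matrix_matrix_mult_def mat_def)
qed

section \<open>The minimal polynomial\<close>

text \<open>More vectors than the dimension are dependent. Dependence of a set does not see repeated
  values, so a non-injective \<open>f\<close> gets its relation from two equal terms.\<close>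

lemma linear_relation_exists:
  fixes f :: "nat \<Rightarrow> 'a::euclidean_space"
  obtains c and N :: nat where "(\<Sum>i\<le>N. c i *\<^sub>R f i) = 0" "\<exists>i\<le>N. c i \<noteq> 0"
proof (cases "inj f")
  case False
  then obtain i j where ij: "f i = f j" "i \<noteq> j"
    by (auto simp: inj_def)
  define c :: "nat \<Rightarrow> real" where "c k = (if k = i then 1 else 0) - (if k = j then 1 else 0)" for k
  have "(\<Sum>k\<le>i + j. c k *\<^sub>R f k) = 0"
    using ij by (simp add: c_def scaleR_diff_left sum_subtractf if_distribR
        if_distrib[of "\<lambda>a. a *\<^sub>R _"] cong: if_cong)
  moreover have "c i \<noteq> 0"
    using ij by (simp add: c_def)
  ultimately show ?thesis
    by (intro that[where c = c and N = "i + j"] exI[of _ i]) simp_all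
next
  case True
  define N where "N = DIM('a)"
  have "card (f ` {..N}) > DIM('a)"
    using True by (simp add: N_def card_image inj_on_subset)
  then have "dependent (f ` {..N})"
    by (rule dependent_biggerset)
  then obtain u v where u: "v \<in> f ` {..N}" "u v \<noteq> 0" "(\<Sum>v\<in>f ` {..N}. u v *\<^sub>R v) = 0"
    by (auto simp: dependent_finite)
  have "(\<Sum>i\<le>N. u (f i) *\<^sub>R f i) = 0"
    using u(3) True by (subst (asm) sum.reindex) (auto intro: inj_on_subset)
  with u show ?thesis
    using that[where c = "\<lambda>i. u (f i)" and N = N] by auto
qed

text \<open>The powers of \<open>A\<close> lie in a finite-dimensional space; the coefficients of a
  linear relation among them give \<open>p\<close>.\<close>

lemma annihilating_poly_exists:
  fixes A :: "real^'n^'n"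
  obtains p where "p \<noteq> 0" "poly_mat p A = 0"
proof -
  obtain c N where c: "(\<Sum>i\<le>N. c i *\<^sub>R mat_power A i) = 0" "\<exists>i\<le>N. c i \<noteq> 0"
    by (rule linear_relation_exists)
  define p where "p = (\<Sum>i\<le>N. monom (c i) i)"
  have coeff: "coeff p i = (if i \<le> N then c i else 0)" for i
    by (simp add: p_def coeff_sum)
  have "degree p \<le> N"
    by (rule degree_le) (simp add: coeff)
  then have "poly_mat p A = (\<Sum>i\<le>N. c i *\<^sub>R mat_power A i)"
    by (simp add: vec_eq_iff poly_mat_nth[of p N] coeff)
  moreover have "p \<noteq> 0"
    using c(2) coeff by (metis coeff_0)
  ultimately show ?thesis
    using that c(1) by simp
qed

lemma complex_mat_nth [simp]: "complex_mat B $ x $ y = complex_of_real (B $ x $ y)"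
  by (simp add: complex_mat_def map_matrix_def)

text \<open>Carries an annihilating polynomial of a real matrix over to its complex copy.\<close>

lemma poly_mat_complex:
  "poly_mat (map_poly of_real p) (complex_mat A) = complex_mat (poly_mat p A)"
proof (induction p)
  case 0
  then show ?case
    by (simp add: vec_eq_iff)
next
  case (pCons a p)
  have "map_poly of_real (pCons a p) = pCons (of_real a :: complex) (map_poly of_real p)"
    by (simp add: map_poly_pCons)
  then show ?case
    by (simp add: pCons.IH poly_mat_pCons)
      (simp add: vec_eq_iff matrix_matrix_mult_def mat_def)
qed

text \<open>As \<open>min_poly\<close> is a definite description, a monic annihilating polynomial of
  least degree has to be shown to exist and to be unique.\<close>

lemma min_poly_complex_mat:
  fixes B :: "real^'n^'n"
  shows "lead_coeff (min_poly (complex_mat B)) = 1"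
    and "poly_mat (min_poly (complex_mat B)) (complex_mat B) = 0"
    and "\<And>p. poly_mat p (complex_mat B) = 0 \<Longrightarrow> degree p < degree (min_poly (complex_mat B)) \<Longrightarrow> p = 0"
proof -
  define A where "A = complex_mat B"
  define P where "P = (\<lambda>p. lead_coeff p = 1 \<and> poly_mat p A = 0)"
  have monic: "P (smult (inverse (lead_coeff p)) p)" if "p \<noteq> 0" "poly_mat p A = 0" for p
    using that by (simp add: P_def vec_eq_iff poly_mat_smult_nth)
  obtain r where r: "r \<noteq> 0" "poly_mat r B = 0"
    by (rule annihilating_poly_exists)
  have "\<exists>m. P m"
  proof -
    have "map_poly of_real r \<noteq> (0 :: complex poly)"
      using r(1) by (simp add: map_poly_eq_0_iff)
    moreover have "poly_mat (map_poly of_real r) A = 0"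
      using r(2) by (simp add: A_def poly_mat_complex) (simp add: vec_eq_iff)
    ultimately show ?thesis
      using monic by blast
  qed
  then obtain m where m: "is_arg_min degree P m"
    by (metis is_arg_min_arg_min_nat)
  have least: "p = 0" if "poly_mat p A = 0" "degree p < degree m" for p
  proof (rule ccontr)
    assume "p \<noteq> 0"
    then have "degree (smult (inverse (lead_coeff p)) p) = degree p"
      by simp
    then show False
      using that m monic[OF \<open>p \<noteq> 0\<close>] unfolding is_arg_min_def by metis
  qed
  have "m' = m" if m': "is_arg_min degree P m'" for m'
  proof (rule ccontr)
    assume "m' \<noteq> m"
    have deg: "degree m' = degree m"
      using m m' unfolding is_arg_min_def by (metis nat_neq_iff)
    \<comment> \<open>Both are monic of the same degree, so the leading terms cancel and the
      difference annihilates \<open>A\<close> in smaller degree.\<close>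
    have "coeff (m' - m) (degree m) = 0"
      using m m' deg by (simp add: is_arg_min_def P_def)
    with \<open>m' \<noteq> m\<close> have "degree (m' - m) < degree m"
      by (metis coeff_0 deg degree_diff_le leading_coeff_0_iff le_neq_implies_less order_refl right_minus_eq)
    moreover have "poly_mat (m' - m) A = 0"
      using m m' by (simp add: is_arg_min_def P_def poly_mat_diff)
    ultimately show False
      using least \<open>m' \<noteq> m\<close> by fastforce
  qed
  then have "min_poly A = m"
    unfolding min_poly_def P_def[symmetric] using m by (rule the_equality[rotated])
  with m least show "lead_coeff (min_poly (complex_mat B)) = 1"
    "poly_mat (min_poly (complex_mat B)) (complex_mat B) = 0"
    "\<And>p. poly_mat p (complex_mat B) = 0 \<Longrightarrow> degree p < degree (min_poly (complex_mat B)) \<Longrightarrow> p = 0"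
    by (auto simp: is_arg_min_def P_def A_def)
qed

section \<open>Irreducible matrices\<close>

lemma permutation_conjugate_nth:
  fixes B :: "'a::semiring_1^'n^'n"
  assumes "P = (\<chi> x y. if x = \<pi> y then 1 else 0)"
  shows "(transpose P ** B ** P) $ x $ y = B $ \<pi> x $ \<pi> y"
  by (simp add: assms matrix_matrix_mult_def transpose_def if_distrib if_distribR cong: if_cong)

text \<open>Frees reducibility of enumerations and permutations: \<open>S\<close> collects the
  indices of the first diagonal block.\<close>

lemma reducible_matrix_iff:
  fixes B :: "'a::semiring_1^'n^'n"
  shows "reducible_matrix B \<longleftrightarrow>
    (\<exists>S. S \<noteq> {} \<and> S \<noteq> UNIV \<and> (\<forall>x y. x \<notin> S \<longrightarrow> y \<in> S \<longrightarrow> B $ x $ y = 0))"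
    (is "_ \<longleftrightarrow> (\<exists>S. ?Q S)")
proof
  assume "reducible_matrix B"
  then obtain e P \<pi> k where e: "bij_betw e {..<CARD('n)} (UNIV :: 'n set)"
    and \<pi>: "bij \<pi>" "P = (\<chi> x y. if x = \<pi> y then 1 else 0)"
    and k: "0 < k" "k < CARD('n)"
    and zero: "\<And>i j. k \<le> i \<Longrightarrow> i < CARD('n) \<Longrightarrow> j < k \<Longrightarrow> (transpose P ** B ** P) $ e i $ e j = 0"
    by (auto simp: reducible_matrix_def block_upper_triangular_def permutation_matrix_def)
  \<comment> \<open>Conjugation by \<open>P\<close> relabels indices by \<open>\<pi>\<close>, so
    \<open>f\<close> lists them in an order that makes \<open>B\<close> itself block
    triangular.\<close>
  define f where "f = \<pi> \<circ> e"
  have f: "bij_betw f {..<CARD('n)} UNIV"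
    unfolding f_def using e \<pi>(1) by (rule bij_betw_trans)
  define S where "S = f ` {..<k}"
  have "card S = k"
    unfolding S_def using f k
    by (subst card_image) (auto simp: bij_betw_def intro: inj_on_subset)
  with k have "S \<noteq> {}" "S \<noteq> UNIV"
    by auto
  moreover have "B $ x $ y = 0" if "x \<notin> S" "y \<in> S" for x y
  proof -
    obtain i where i: "i < CARD('n)" "x = f i"
      using f unfolding bij_betw_def by (metis UNIV_I imageE lessThan_iff)
    moreover obtain j where "j < k" "y = f j"
      using \<open>y \<in> S\<close> by (auto simp: S_def)
    moreover have "k \<le> i"
      using that(1) i by (force simp: S_def)
    ultimately show ?thesis
      using zero[of i j] by (simp add: permutation_conjugate_nth[OF \<pi>(2)] f_def)
  qed
  ultimately show "\<exists>S. ?Q S"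
    by blast
next
  assume "\<exists>S. ?Q S"
  then obtain S where S: "?Q S" ..
  define k where "k = card S"
  have k: "0 < k" "k < CARD('n)"
    using S by (auto simp: k_def card_gt_0_iff intro: psubset_card_mono)
  obtain f where f: "bij_betw f {..<k} S"
    using ex_bij_betw_nat_finite[of S] by (auto simp: k_def atLeast0LessThan)
  have "card {k..<CARD('n)} = card (- S)"
    unfolding Compl_eq_Diff_UNIV by (subst card_Diff_subset) (auto simp: k_def)
  then obtain g where g: "bij_betw g {k..<CARD('n)} (- S)"
    using finite_same_card_bij[OF finite_atLeastLessThan finite] by metis
  \<comment> \<open>Listing \<open>S\<close> first already produces the block shape, so the identity
    serves as permutation matrix.\<close>
  define e where "e i = (if i < k then f i else g i)" for i
  have eS: "bij_betw e {..<k} S"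
    using f by (rule bij_betw_cong[THEN iffD1, rotated]) (simp add: e_def)
  have eC: "bij_betw e {k..<CARD('n)} (- S)"
    using g by (rule bij_betw_cong[THEN iffD1, rotated]) (simp add: e_def)
  have "bij_betw e ({..<k} \<union> {k..<CARD('n)}) (S \<union> - S)"
    using eS eC by (rule bij_betw_combine) auto
  moreover have "{..<k} \<union> {k..<CARD('n)} = {..<CARD('n)}"
    using k by auto
  ultimately have "bij_betw e {..<CARD('n)} UNIV"
    by simp
  moreover have P: "(mat 1 :: 'a^'n^'n) = (\<chi> x y. if x = id y then 1 else 0)"
    by (simp add: mat_def)
  then have "permutation_matrix (mat 1 :: 'a^'n^'n)"
    unfolding permutation_matrix_def using bij_id by blast
  moreover have "block_upper_triangular e (transpose (mat 1) ** B ** mat 1)"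
    unfolding block_upper_triangular_def permutation_conjugate_nth[OF P]
  proof (intro exI[of _ k] conjI k allI impI)
    fix i j
    assume "k \<le> i \<and> i < CARD('n) \<and> j < k"
    then have "e i \<in> - S" "e j \<in> S"
      using bij_betwE[OF eS] bij_betwE[OF eC] by auto
    then show "B $ id (e i) $ id (e j) = 0"
      using S by simp
  qed
  ultimately show "reducible_matrix B"
    unfolding reducible_matrix_def by blast
qed

text \<open>The set on which \<open>v\<close> attains its maximum is closed under the edges of \<open>B\<close>.\<close>

lemma irreducible_eigenvector_constant:
  fixes B :: "real^'n^'n"
  assumes irr: "irreducible_matrix B" and nonneg: "nonneg_matrix B"
    and rows: "\<And>x. (\<Sum>y\<in>UNIV. B $ x $ y) = lam"
    and eigen: "\<And>x. (\<Sum>y\<in>UNIV. B $ x $ y * v y) = lam * v x"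
  shows "v x = v y"
proof -
  define M where "M = Max (range v)"
  define S where "S = {z. v z \<noteq> M}"
  have le: "v z \<le> M" for z
    by (simp add: M_def)
  have "M \<in> range v"
    unfolding M_def by (rule Max_in) auto
  then have "S \<noteq> UNIV"
    by (auto simp: S_def)
  moreover have "B $ x $ z = 0" if "x \<notin> S" "z \<in> S" for x z
  proof -
    \<comment> \<open>At a maximum point \<open>x\<close> the nonnegative terms weighting the gaps
      \<open>M - v y\<close> sum to zero, so each vanishes; the gap at \<open>z\<close> is
      nonzero.\<close>
    have "(\<Sum>y\<in>UNIV. B $ x $ y * (M - v y)) = lam * M - lam * v x"
      by (simp add: right_diff_distrib sum_subtractf eigen rows flip: sum_distrib_right)
    also have "\<dots> = 0"
      using that by (simp add: S_def)
    finally have "B $ x $ z * (M - v z) = 0"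
      using nonneg le by (subst (asm) sum_nonneg_eq_0_iff) (auto simp: nonneg_matrix_def)
    then show ?thesis
      using that by (simp add: S_def)
  qed
  ultimately have "S = {}"
    using irr unfolding irreducible_matrix_def reducible_matrix_iff by blast
  then show ?thesis
    by (auto simp: S_def)
qed

section \<open>Polynomials in a matrix that evaluate to the all-ones matrix\<close>

lemma all_ones_nth [simp]: "all_ones $ x $ y = 1"
  by (simp add: all_ones_def)

lemma all_ones_poly_imp_irreducible:
  assumes "poly_mat p (complex_mat B) = all_ones"
  shows "irreducible_matrix B"
  unfolding irreducible_matrix_def reducible_matrix_iff
proof (rule notI, elim exE conjE)
  fix S
  assume S: "S \<noteq> {}" "S \<noteq> UNIV" "\<forall>x y. x \<notin> S \<longrightarrow> y \<in> S \<longrightarrow> B $ x $ y = 0"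
  then obtain x y where "x \<notin> S" "y \<in> S"
    by blast
  then have "poly_mat p (complex_mat B) $ x $ y = 0"
    using S by (intro poly_mat_zero_block[of S]) auto
  then show False
    by (simp add: assms)
qed

lemma all_ones_poly_imp_doubly_stochastic:
  assumes "nonneg_matrix B" "poly_mat p (complex_mat B) = all_ones"
  obtains lam where "doubly_stochastic lam B"
proof -
  have "complex_mat B ** all_ones = all_ones ** complex_mat B"
    using poly_mat_commute[of p "complex_mat B"] assms(2) by simp
  \<comment> \<open>Entry \<open>(x, y)\<close> of BJ is the row sum at \<open>x\<close>, that of JB
    the column sum at \<open>y\<close>.\<close>
  then have "complex_of_real (\<Sum>z\<in>UNIV. B $ x $ z) = complex_of_real (\<Sum>z\<in>UNIV. B $ z $ y)" for x y
    by (simp add: vec_eq_iff matrix_matrix_mult_def)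
  then have "(\<Sum>z\<in>UNIV. B $ x $ z) = (\<Sum>z\<in>UNIV. B $ z $ y)" for x y
    using of_real_eq_iff by blast
  \<comment> \<open>All these sums agree, so the row at the arbitrary index \<open>undefined\<close>
    supplies the common value.\<close>
  then have "doubly_stochastic (\<Sum>z\<in>UNIV. B $ undefined $ z) B"
    using assms(1) unfolding doubly_stochastic_def by metis
  then show ?thesis
    by (rule that)
qed

lemma eigen_poly_mat_eq:
  fixes B :: "real^'n^'n"
  assumes irr: "irreducible_matrix B" and ds: "doubly_stochastic lam B"
    and zero: "poly_mat ([:- complex_of_real lam, 1:] * q) (complex_mat B) = 0"
  shows "poly_mat q (complex_mat B) $ x $ y * of_nat CARD('n) = poly q (complex_of_real lam)"
proof -
  define Q where "Q = poly_mat q (complex_mat B)"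
  have nonneg: "nonneg_matrix B" and rows: "\<And>x. (\<Sum>y\<in>UNIV. B $ x $ y) = lam"
    and columns: "\<And>y. (\<Sum>x\<in>UNIV. B $ x $ y) = lam"
    using ds by (auto simp: doubly_stochastic_def)
  have eigen: "(\<Sum>z\<in>UNIV. of_real (B $ x $ z) * Q $ z $ y) = of_real lam * Q $ x $ y" for x
    using poly_mat_linear_mult_nth[of "complex_of_real lam" q "complex_mat B" x y] zero
    by (simp add: Q_def matrix_matrix_mult_def)
  \<comment> \<open>The maximum principle needs real vectors. Since \<open>B\<close> and
    \<open>lam\<close> are real, the real and imaginary parts of a column each satisfy the
    eigenvector equation.\<close>
  have const: "Q $ z $ y = Q $ x $ y" for z
  proof (rule complex_eqI)
    show "Re (Q $ z $ y) = Re (Q $ x $ y)"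
      using arg_cong[OF eigen, of Re]
      by (intro irreducible_eigenvector_constant[OF irr nonneg rows]) simp
    show "Im (Q $ z $ y) = Im (Q $ x $ y)"
      using arg_cong[OF eigen, of Im]
      by (intro irreducible_eigenvector_constant[OF irr nonneg rows]) simp
  qed
  have "(\<Sum>z\<in>UNIV. Q $ z $ y) = poly q (complex_of_real lam)"
    unfolding Q_def by (rule poly_mat_column_sum) (simp add: columns flip: of_real_sum)
  also have "(\<Sum>z\<in>UNIV. Q $ z $ y) = (\<Sum>z\<in>(UNIV :: 'n set). Q $ x $ y)"
    using const by (rule sum.cong[OF refl])
  finally show ?thesis
    by (simp add: Q_def mult.commute)
qed

lemma min_poly_factor:
  fixes B :: "real^'n^'n"
  assumes irr: "irreducible_matrix B" and ds: "doubly_stochastic lam B"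
  obtains q where "min_poly (complex_mat B) = [:- complex_of_real lam, 1:] * q"
    "poly q (complex_of_real lam) \<noteq> 0"
    "\<And>h. is_arg_min degree (\<lambda>p. poly_mat p (complex_mat B) = all_ones) h \<longleftrightarrow>
       h = smult (of_nat CARD('n) / poly q (complex_of_real lam)) q"
proof -
  define A where "A = complex_mat B"
  define l where "l = complex_of_real lam"
  note m = min_poly_complex_mat[where B = B, folded A_def]
  \<comment> \<open>\<open>l\<close> is a root because the value there is a row sum of the zero
    matrix.\<close>
  have "poly (min_poly A) l = (\<Sum>y\<in>UNIV. poly_mat (min_poly A) A $ undefined $ y)"
    using ds unfolding A_def l_def
    by (intro poly_mat_row_sum[symmetric]) (simp add: doubly_stochastic_def flip: of_real_sum)
  also have "\<dots> = 0"
    by (simp add: m)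
  finally have "[:- l, 1:] dvd min_poly A"
    by (simp add: poly_eq_0_iff_dvd)
  then obtain q where q: "min_poly A = [:- l, 1:] * q" ..
  then have "q \<noteq> 0"
    using m(1) by auto
  then have deg: "degree q < degree (min_poly A)"
    unfolding q by (subst degree_mult_eq) auto
  have Q: "poly_mat q A $ x $ y * of_nat CARD('n) = poly q l" for x y
    unfolding A_def l_def
    by (rule eigen_poly_mat_eq[OF irr ds]) (rule m(2)[unfolded q, unfolded A_def l_def])
  \<comment> \<open>Otherwise \<open>Q\<close> would make \<open>q\<close> a nonzero annihilating
    polynomial of degree below the minimal one.\<close>
  have ql: "poly q l \<noteq> 0"
  proof
    assume "poly q l = 0"
    then have "poly_mat q A = 0"
      using Q by (simp add: vec_eq_iff)
    then show False
      using m(3) deg \<open>q \<noteq> 0\<close> by blast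
  qed
  define h where "h = smult (of_nat CARD('n) / poly q l) q"
  have h: "poly_mat h A = all_ones"
    using Q ql by (simp add: vec_eq_iff h_def poly_mat_smult_nth mult.commute)
  \<comment> \<open>Two solutions of degree below that of the minimal polynomial differ by an
    annihilating polynomial that is too small to be nonzero. This gives both minimality and
    uniqueness of \<open>h\<close>.\<close>
  have unique: "p = h" if "poly_mat p A = all_ones" "degree p \<le> degree h" for p
  proof -
    have "degree h < degree (min_poly A)"
      using deg ql by (simp add: h_def)
    then have "degree (p - h) < degree (min_poly A)"
      using that(2) by (intro degree_diff_less) auto
    moreover have "poly_mat (p - h) A = 0"
      using that(1) h by (simp add: poly_mat_diff)
    ultimately show ?thesis
      using m(3) by fastforce
  qed
  have "is_arg_min degree (\<lambda>p. poly_mat p A = all_ones) p \<longleftrightarrow> p = h" for p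
    using h unique unfolding is_arg_min_def by (metis less_imp_le not_le)
  then show ?thesis
    using that[of q] q ql unfolding A_def l_def h_def by blast
qed

theorem theorem1p1:
  fixes B :: "real^'n^'n"
  assumes "nonneg_matrix B"
  shows "((\<exists>p :: complex poly. poly_mat p (complex_mat B) = all_ones) \<longleftrightarrow>
            irreducible_matrix B \<and> (\<exists>lam. doubly_stochastic lam B)) \<and>
         (\<forall>lam. irreducible_matrix B \<and> doubly_stochastic lam B \<longrightarrow>
            (\<exists>q :: complex poly.
               min_poly (complex_mat B) = [:- complex_of_real lam, 1:] * q \<and>
               poly q (complex_of_real lam) \<noteq> 0 \<and>
               (\<forall>h. is_arg_min degree (\<lambda>p. poly_mat p (complex_mat B) = all_ones) h \<longleftrightarrow>
                  h = smult (of_nat CARD('n) / poly q (complex_of_real lam)) q)))"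
proof (intro conjI allI impI iffI)
  assume "\<exists>p :: complex poly. poly_mat p (complex_mat B) = all_ones"
  then obtain p :: "complex poly" where p: "poly_mat p (complex_mat B) = all_ones" ..
  then show "irreducible_matrix B"
    by (rule all_ones_poly_imp_irreducible)
  show "\<exists>lam. doubly_stochastic lam B"
    using all_ones_poly_imp_doubly_stochastic[OF assms p] by blast
next
  assume "irreducible_matrix B \<and> (\<exists>lam. doubly_stochastic lam B)"
  then obtain lam where "irreducible_matrix B" "doubly_stochastic lam B"
    by blast
  then show "\<exists>p :: complex poly. poly_mat p (complex_mat B) = all_ones"
    \<comment> \<open>The minimiser described there is itself a solution.\<close>
    by (rule min_poly_factor) (auto simp: is_arg_min_def)
next
  fix lam
  assume "irreducible_matrix B \<and> doubly_stochastic lam B"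
  then show "\<exists>q :: complex poly.
      min_poly (complex_mat B) = [:- complex_of_real lam, 1:] * q \<and>
      poly q (complex_of_real lam) \<noteq> 0 \<and>
      (\<forall>h. is_arg_min degree (\<lambda>p. poly_mat p (complex_mat B) = all_ones) h \<longleftrightarrow>
         h = smult (of_nat CARD('n) / poly q (complex_of_real lam)) q)"
    by (metis min_poly_factor)
qed

end
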